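(* The following hold. (i) For all positive integers $v>6$ and $m$ with $v\equiv 5,17,35,47\pmod{60}$ and $m\le (v-1)/2$ there is a simple $3-\bigl(2v,8,\tfrac{7}{30}v(v-2)(v-3)(v-5)m\bigr)$ design. (ii) For all positive integers $v>8$ and $m$ with $v\equiv 7,23,63,111,167,191,223,231,247\pmod{280}$ and $m\le (v-1)/2$ there is a simple $3-\Bigl(2v,10,\frac{81\,v\,m}{7(v-5)}\binom{v-2}{6}\Bigr)$ design.
   Context: A $t-(v,k,\lambda)$ design is a pair $(X,\mathcal B)$ with $|X|=v$ and $\mathcal B$ a collection of $k$-subsets (blocks) of $X$ such that every $t$-subset of $X$ is contained in exactly $\lambda$ blocks. It is simple if it has no repeated blocks. *)

theory Defs
  imports Complex_Main "HOL-Library.Multiset" "HOL-Number_Theory.Cong"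
begin

text \<open>Blocks form a multiset, so that a design may have repeated blocks unless it is simple.\<close>

definition is_design :: "nat \<Rightarrow> nat \<Rightarrow> nat \<Rightarrow> nat \<Rightarrow> 'a set \<Rightarrow> 'a set multiset \<Rightarrow> bool" where
  "is_design t v k l X \<B> \<longleftrightarrow>
     finite X \<and> card X = v \<and>
     (\<forall>b\<in>#\<B>. b \<subseteq> X \<and> card b = k) \<and>
     (\<forall>T. T \<subseteq> X \<and> card T = t \<longrightarrow> size {#b \<in># \<B>. T \<subseteq> b#} = l)"

definition simple_blocks :: "'a set multiset \<Rightarrow> bool" where
  "simple_blocks \<B> \<longleftrightarrow> (\<forall>b. count \<B> b \<le> 1)"

text \<open>The index is passed as a real number because it is given by formulas containing quotients;
  the predicate asserts in particular that it is a natural number. Since only finite point sets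
  occur, points may be taken to be natural numbers.\<close>

definition simple_design_exists :: "nat \<Rightarrow> nat \<Rightarrow> nat \<Rightarrow> real \<Rightarrow> bool" where
  "simple_design_exists t v k r \<longleftrightarrow>
     (\<exists>(l::nat) (X::nat set) \<B>. real l = r \<and> is_design t v k l X \<B> \<and> simple_blocks \<B>)"

end

theory Submission imports Defs
begin

text \<open>
  The points are two copies of \<open>\<int>/v\<close>, so a block of size \<open>2h\<close> (with \<open>h = 4\<close> or \<open>h = 5\<close>) is a pair
  \<open>(A, B)\<close> of subsets of \<open>\<int>/v\<close> whose sizes add up to \<open>2h\<close>. Blocks of types \<open>(2h - 2, 2)\<close>,
  \<open>(2, 2h - 2)\<close> and \<open>(h, h)\<close> are used. Since the first two types mirror each other and the third is
  biregular with equal degrees, two counts remain to be compared: how often three points of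
  one copy are covered, and how often two points of one copy and one point of the other.

  If \<open>k\<close> is coprime to \<open>v\<close>, then every orbit of translation on the \<open>k\<close>-subsets has \<open>v\<close> members
  and covers every point \<open>k\<close> times (\<open>resolution_into_1_designs\<close>). Join the orbits of \<open>i\<close>-subsets
  to the orbits of \<open>j\<close>-subsets by a biregular relation (\<open>biregular_relation\<close>) with degrees \<open>p\<close>
  and \<open>q\<close>, and take all pairs \<open>(A, B)\<close> from joined orbits. A given \<open>A\<close> then has exactly \<open>p v\<close>
  partners, and exactly \<open>p j\<close> of them contain a prescribed point; symmetrically for \<open>B\<close>. In a triple
  split over the two copies at least one part has at most one point, so these numbers determine
  how often a triple is covered, and the answer depends only on the type of the triple
  (\<open>cover_balanced\<close>).

  The orbits of pairs correspond to the \<open>(v - 1) / 2\<close> differences up to sign; joining each orbit of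
  \<open>(2h - 2)\<close>-subsets to \<open>m\<close> of them gives the range of \<open>m\<close>. The number of \<open>(h, h)\<close>-blocks is then
  forced by the requirement that the two coverage counts agree. Each orbit of \<open>h\<close>-subsets is joined
  to \<open>(v + 3)(v - 5) m / 15\<close> such orbits when \<open>h = 4\<close>, and to \<open>(13 v + 16)(v - 6)(v - 7) m / 840\<close>
  when \<open>h = 5\<close>. The congruences on \<open>v\<close> guarantee that these degrees are integers, that the orbits of
  pairs can all be given the same degree, and that \<open>2\<close>, \<open>h\<close> and \<open>2h - 2\<close> are coprime to \<open>v\<close>.
\<close>

section \<open>Subsets of an initial segment of the natural numbers\<close>

definition ksets :: "nat \<Rightarrow> nat \<Rightarrow> nat set set" where
  "ksets v k = {A. A \<subseteq> {..<v} \<and> card A = k}"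

lemma finite_ksets [simp]: "finite (ksets v k)"
  by (rule finite_subset[of _ "Pow {..<v}"]) (auto simp: ksets_def)

lemma card_ksets: "card (ksets v k) = v choose k"
  using n_subsets[of "{..<v}" k] by (simp add: ksets_def)

lemma card_ksets_superset:
  assumes T: "T \<subseteq> {..<v}"
  shows "card {A \<in> ksets v k. T \<subseteq> A} =
           (if card T \<le> k then (v - card T) choose (k - card T) else 0)"
proof (cases "card T \<le> k")
  case True
  have fT: "finite T" using T finite_subset by blast
  have "bij_betw (\<lambda>A. A \<union> T) {B. B \<subseteq> {..<v} - T \<and> card B = k - card T} {A \<in> ksets v k. T \<subseteq> A}"
  proof (rule bij_betw_byWitness[where f' = "\<lambda>A. A - T"])
    show "\<forall>B\<in>{B. B \<subseteq> {..<v} - T \<and> card B = k - card T}. B \<union> T - T = B"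
      by (simp add: Un_Diff Diff_triv disjoint_eq_subset_Compl) blast
    show "\<forall>A\<in>{A \<in> ksets v k. T \<subseteq> A}. A - T \<union> T = A" by auto
    show "(\<lambda>A. A \<union> T) ` {B. B \<subseteq> {..<v} - T \<and> card B = k - card T} \<subseteq> {A \<in> ksets v k. T \<subseteq> A}"
    proof clarsimp
      fix B assume B: "B \<subseteq> {..<v} - T" "card B = k - card T"
      have "finite B" using B finite_subset by blast
      then have "card (B \<union> T) = card B + card T" using B fT by (intro card_Un_disjoint) auto
      then show "B \<union> T \<in> ksets v k" using B T True by (auto simp: ksets_def)
    qed
    show "(\<lambda>A. A - T) ` {A \<in> ksets v k. T \<subseteq> A} \<subseteq> {B. B \<subseteq> {..<v} - T \<and> card B = k - card T}"
      using fT by (auto simp: ksets_def card_Diff_subset)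
  qed
  then have "card {A \<in> ksets v k. T \<subseteq> A} = card {B. B \<subseteq> {..<v} - T \<and> card B = k - card T}"
    by (rule bij_betw_same_card[symmetric])
  also have "\<dots> = (v - card T) choose (k - card T)"
    using T fT by (simp add: n_subsets card_Diff_subset)
  finally show ?thesis using True by simp
next
  case False
  have "\<not> T \<subseteq> A" if "A \<in> ksets v k" for A
  proof
    assume "T \<subseteq> A"
    moreover have "finite A" using that finite_subset[of A "{..<v}"] by (simp add: ksets_def)
    ultimately have "card T \<le> card A" by (simp add: card_mono)
    with False that show False by (simp add: ksets_def)
  qed
  then have "{A \<in> ksets v k. T \<subseteq> A} = {}" by blast
  with False show ?thesis by (simp only: card.empty if_False)
qed

section \<open>Translation orbits as 1-designs\<close>

definition rot :: "nat \<Rightarrow> nat \<Rightarrow> nat set \<Rightarrow> nat set" where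
  "rot v d A = (\<lambda>x. (x + d) mod v) ` A"

lemma rot_inverse:
  assumes "A \<subseteq> {..<v}" "d \<le> v"
  shows "rot v (v - d) (rot v d A) = A"
proof -
  have "((x + d) mod v + (v - d)) mod v = x" if "x \<in> A" for x
  proof -
    have "((x + d) mod v + (v - d)) mod v = (x + d + (v - d)) mod v" by (simp add: mod_add_left_eq)
    also have "\<dots> = x" using that assms by auto
    finally show ?thesis .
  qed
  then show ?thesis by (simp add: rot_def image_image)
qed

lemma inj_on_shift:
  "inj_on (\<lambda>x. (x + d) mod v) {..<v::nat}"
proof (rule inj_onI)
  fix x y assume "x \<in> {..<v}" "y \<in> {..<v}" "(x + d) mod v = (y + d) mod v"
  then have "[x + d = y + d] (mod v)" by (simp add: cong_def)
  then have "[x = y] (mod v)" by (simp add: cong_add_rcancel_nat)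
  with \<open>x \<in> {..<v}\<close> \<open>y \<in> {..<v}\<close> show "x = y" by (simp add: cong_def)
qed

lemma rot_in_ksets:
  assumes "0 < v" "A \<in> ksets v k"
  shows "rot v d A \<in> ksets v k"
  using assms card_image[OF inj_on_subset[OF inj_on_shift[of d v], of A]]
  by (auto simp: ksets_def rot_def)

text \<open>When \<open>k\<close> is invertible modulo \<open>v\<close>, this tells the translates of a \<open>k\<close>-subset apart by their
  element sums.\<close>

lemma sum_rot_cong:
  assumes "A \<in> ksets v k"
  shows "[\<Sum>(rot v d A) = \<Sum>A + k * d] (mod v)"
proof -
  have "\<Sum>(rot v d A) = (\<Sum>x\<in>A. (x + d) mod v)"
    using assms inj_on_subset[OF inj_on_shift[of d v], of A]
    by (simp add: rot_def sum.reindex ksets_def)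
  also have "[\<dots> = (\<Sum>x\<in>A. x + d)] (mod v)"
    by (simp add: cong_def mod_sum_eq)
  also have "(\<Sum>x\<in>A. x + d) = \<Sum>A + k * d"
    using assms by (simp add: sum.distrib ksets_def)
  finally show ?thesis .
qed

text \<open>For \<open>k\<close> coprime to \<open>v\<close> these form a system of representatives of the translation orbits.\<close>

definition zero_sum_sets :: "nat \<Rightarrow> nat \<Rightarrow> nat set set" where
  "zero_sum_sets v k = {A \<in> ksets v k. v dvd \<Sum>A}"

text \<open>Translation by \<open>d\<close> shifts the element sum by \<open>k d\<close>, and \<open>d \<mapsto> k d\<close> permutes the residues
  modulo \<open>v\<close>; hence exactly one translate of each \<open>k\<close>-subset has sum zero.\<close>

lemma bij_betw_rot_zero_sum:
  assumes v: "0 < v" and cop: "coprime v k"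
  shows "bij_betw (\<lambda>(d, A). rot v d A) ({..<v} \<times> zero_sum_sets v k) (ksets v k)"
  unfolding bij_betw_def
proof
  show "inj_on (\<lambda>(d, A). rot v d A) ({..<v} \<times> zero_sum_sets v k)"
  proof (rule inj_onI, clarsimp)
    fix d A e B
    assume d: "d < v" and e: "e < v" and A: "A \<in> zero_sum_sets v k" and B: "B \<in> zero_sum_sets v k"
      and eq: "rot v d A = rot v e B"
    have "[k * d = k * e] (mod v)"
    proof -
      have A0: "[\<Sum>A = 0] (mod v)" and B0: "[\<Sum>B = 0] (mod v)"
        using A B by (auto simp: zero_sum_sets_def cong_0_iff)
      have "[\<Sum>A + k * d = \<Sum>B + k * e] (mod v)"
        using sum_rot_cong[of A v k d] sum_rot_cong[of B v k e] A B eq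
        by (simp add: zero_sum_sets_def cong_def)
      moreover have "[\<Sum>A + k * d = 0 + k * d] (mod v)" using A0 by (intro cong_add) auto
      moreover have "[\<Sum>B + k * e = 0 + k * e] (mod v)" using B0 by (intro cong_add) auto
      ultimately show ?thesis by (simp add: cong_def)
    qed
    then have "[d = e] (mod v)" using cop by (simp add: cong_mult_lcancel_nat coprime_commute)
    then have de: "d = e" using d e by (simp add: cong_def)
    have "A = B"
    proof -
      have "A \<subseteq> {..<v}" "B \<subseteq> {..<v}" using A B by (auto simp: zero_sum_sets_def ksets_def)
      then show ?thesis using rot_inverse d eq unfolding de by (metis less_imp_le)
    qed
    with de show "d = e \<and> A = B" by simp
  qed
  show "(\<lambda>(d, A). rot v d A) ` ({..<v} \<times> zero_sum_sets v k) = ksets v k"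
  proof
    show "(\<lambda>(d, A). rot v d A) ` ({..<v} \<times> zero_sum_sets v k) \<subseteq> ksets v k"
      using rot_in_ksets[OF v] by (auto simp: zero_sum_sets_def)
    show "ksets v k \<subseteq> (\<lambda>(d, A). rot v d A) ` ({..<v} \<times> zero_sum_sets v k)"
    proof
      fix A assume A: "A \<in> ksets v k"
      obtain u where u: "[k * u = 1] (mod v)"
        using cong_solve_coprime_nat[of k v] cop by (auto simp: coprime_commute)
      \<comment> \<open>The translation that carries the zero-sum representative to \<open>A\<close> satisfies \<open>k d \<equiv> \<Sum>A\<close>.\<close>
      define d where "d = (u * (\<Sum>A)) mod v"
      have d: "d < v" using v by (simp add: d_def)
      define B where "B = rot v (v - d) A"
      have B: "B \<in> ksets v k" using rot_in_ksets[OF v A] by (simp add: B_def)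
      have AB: "A = rot v d B"
        using rot_inverse[of A v "v - d"] A d by (simp add: B_def ksets_def)
      have "[k * d = k * (u * \<Sum>A)] (mod v)" by (simp add: d_def cong_def mod_mult_right_eq)
      also have "[k * (u * \<Sum>A) = \<Sum>A] (mod v)"
        using cong_mult[OF u cong_refl[of "\<Sum>A" v]] by (simp add: mult.assoc)
      finally have kd: "[k * d = \<Sum>A] (mod v)" .
      have "[\<Sum>B + k * d = \<Sum>A] (mod v)"
        using sum_rot_cong[OF B, of d] AB by (metis cong_sym)
      then have "[\<Sum>B + k * d = 0 + k * d] (mod v)"
        using kd by (simp add: cong_def)
      then have "[\<Sum>B = 0] (mod v)" by (simp only: cong_add_rcancel_nat)
      then have "B \<in> zero_sum_sets v k" using B by (simp add: zero_sum_sets_def cong_0_iff)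
      then show "A \<in> (\<lambda>(d, A). rot v d A) ` ({..<v} \<times> zero_sum_sets v k)"
        using AB d by auto
    qed
  qed
qed

text \<open>For each \<open>x\<close> in \<open>A\<close> there is exactly one translation that moves \<open>x\<close> to \<open>y\<close>,
  and different \<open>x\<close> need different translations.\<close>

lemma card_rotations_through_point:
  assumes v: "0 < v" and A: "A \<in> ksets v k" and y: "y < v"
  shows "card {d. d < v \<and> y \<in> rot v d A} = k"
proof -
  have *: "(x + (y + (v - x)) mod v) mod v = y" if "x < v" for x
  proof -
    have "(x + (y + (v - x)) mod v) mod v = (x + (y + (v - x))) mod v" by (simp add: mod_add_right_eq)
    also have "x + (y + (v - x)) = y + v" using that by simp
    finally show ?thesis using y by simp
  qed
  have "{d. d < v \<and> y \<in> rot v d A} = (\<lambda>x. (y + (v - x)) mod v) ` A"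
  proof
    show "(\<lambda>x. (y + (v - x)) mod v) ` A \<subseteq> {d. d < v \<and> y \<in> rot v d A}"
      using * A v by (force simp: rot_def ksets_def image_iff)
    show "{d. d < v \<and> y \<in> rot v d A} \<subseteq> (\<lambda>x. (y + (v - x)) mod v) ` A"
    proof clarsimp
      fix d assume d: "d < v" and "y \<in> rot v d A"
      then obtain x where x: "x \<in> A" "y = (x + d) mod v" by (auto simp: rot_def)
      have "x < v" using x A by (auto simp: ksets_def)
      have "(y + (v - x)) mod v = (x + d + (v - x)) mod v" using x by (simp add: mod_add_left_eq)
      also have "x + d + (v - x) = d + v" using \<open>x < v\<close> by simp
      finally have "d = (y + (v - x)) mod v" using d by simp
      then show "d \<in> (\<lambda>x. (y + (v - x)) mod v) ` A" using x by blast
    qed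
  qed
  moreover have "inj_on (\<lambda>x. (y + (v - x)) mod v) A"
  proof (rule inj_onI)
    fix x z assume xz: "x \<in> A" "z \<in> A" and eq: "(y + (v - x)) mod v = (y + (v - z)) mod v"
    have lt: "x < v" "z < v" using xz A by (auto simp: ksets_def)
    define d where "d = (y + (v - x)) mod v"
    have "(x + d) mod v = (z + d) mod v" using *[OF lt(1)] *[OF lt(2)] eq by (simp add: d_def)
    then show "x = z" using inj_on_shift[of d v] lt unfolding inj_on_def by blast
  qed
  ultimately show ?thesis using A by (simp add: card_image ksets_def)
qed

text \<open>The colour \<open>c A\<close> numbers the translation orbit of \<open>A\<close>. With the orbits numbered,
  joining orbits becomes a relation between natural numbers.\<close>

lemma resolution_into_1_designs:
  assumes v: "0 < v" and cop: "coprime v k"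
  obtains c :: "nat set \<Rightarrow> nat" and a :: nat
  where "a * v = v choose k"
    and "\<And>A. A \<in> ksets v k \<Longrightarrow> c A < a"
    and "\<And>l. l < a \<Longrightarrow> card {A \<in> ksets v k. c A = l} = v"
    and "\<And>l y. l < a \<Longrightarrow> y < v \<Longrightarrow> card {A \<in> ksets v k. c A = l \<and> y \<in> A} = k"
proof -
  let ?Z = "zero_sum_sets v k" and ?f = "\<lambda>(d, A). rot v d A"
  have finZ: "finite ?Z" by (rule finite_subset[of _ "ksets v k"]) (auto simp: zero_sum_sets_def)
  note bij = bij_betw_rot_zero_sum[OF v cop]
  define a where "a = card ?Z"
  obtain e where e: "bij_betw e ?Z {..<a}"
    using ex_bij_betw_finite_nat[OF finZ] by (auto simp: a_def atLeast0LessThan)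
  define g where "g = inv_into ({..<v} \<times> ?Z) ?f"
  define c where "c = (\<lambda>A. e (snd (g A)))"
  have c_rot: "c (rot v d A) = e A" if "d < v" "A \<in> ?Z" for d A
    using that bij inv_into_f_f[of ?f "{..<v} \<times> ?Z" "(d, A)"]
    by (auto simp: c_def g_def bij_betw_def)
  have rot_ex: "\<exists>d B. d < v \<and> B \<in> ?Z \<and> A = rot v d B" if "A \<in> ksets v k" for A
  proof -
    have "A \<in> ?f ` ({..<v} \<times> ?Z)" using that bij by (simp add: bij_betw_def)
    then show ?thesis by (blast intro: dvd_mult dvd_mult2)
  qed
  have rot_in: "rot v d B \<in> ksets v k" if "B \<in> ?Z" for d B
    using that rot_in_ksets[OF v] by (auto simp: zero_sum_sets_def)
  have class_card: "card {A \<in> ksets v k. c A = l \<and> P A} = card {d. d < v \<and> P (rot v d (inv_into ?Z e l))}"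
    if l: "l < a" for l P
  proof -
    let ?B = "inv_into ?Z e l"
    have B: "?B \<in> ?Z" "e ?B = l"
      using e l by (auto simp: bij_betw_def inv_into_into f_inv_into_f)
    have uniq: "C = ?B" if "C \<in> ?Z" "e C = l" for C
      using e that by (auto simp: bij_betw_def)
    have "{A \<in> ksets v k. c A = l \<and> P A} = (\<lambda>d. rot v d ?B) ` {d. d < v \<and> P (rot v d ?B)}"
    proof
      show "{A \<in> ksets v k. c A = l \<and> P A} \<subseteq> (\<lambda>d. rot v d ?B) ` {d. d < v \<and> P (rot v d ?B)}"
      proof
        fix A assume "A \<in> {A \<in> ksets v k. c A = l \<and> P A}"
        then have A: "A \<in> ksets v k" "c A = l" "P A" by auto
        from rot_ex[OF A(1)] obtain d C where d: "d < v" "C \<in> ?Z" "A = rot v d C" by blast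
        then have "C = ?B" using c_rot A by (intro uniq) auto
        then show "A \<in> (\<lambda>d. rot v d ?B) ` {d. d < v \<and> P (rot v d ?B)}" using d A by blast
      qed
      show "(\<lambda>d. rot v d ?B) ` {d. d < v \<and> P (rot v d ?B)} \<subseteq> {A \<in> ksets v k. c A = l \<and> P A}"
        using B c_rot rot_in by auto
    qed
    moreover have "inj_on (\<lambda>d. rot v d ?B) {d. d < v \<and> P (rot v d ?B)}"
      using bij B by (auto simp: bij_betw_def inj_on_def)
    ultimately show ?thesis by (simp add: card_image)
  qed
  show ?thesis
  proof (rule that[of a c])
    show "a * v = v choose k"
      using bij_betw_same_card[OF bij] by (simp add: card_ksets card_cartesian_product a_def mult.commute)
    show "c A < a" if "A \<in> ksets v k" for A
      using rot_ex[OF that] c_rot e by (auto simp: bij_betw_def)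
    show "card {A \<in> ksets v k. c A = l} = v" if "l < a" for l
      using class_card[OF that, of "\<lambda>_. True"] by simp
    show "card {A \<in> ksets v k. c A = l \<and> y \<in> A} = k" if "l < a" "y < v" for l y
    proof -
      have "inv_into ?Z e l \<in> ksets v k"
        using e that(1) inv_into_into[of l e ?Z] by (simp add: bij_betw_def zero_sum_sets_def)
      then show ?thesis
        using class_card[OF that(1), of "\<lambda>A. y \<in> A"] card_rotations_through_point[OF v _ that(2)] by simp
    qed
  qed
qed

section \<open>Balanced families of pairs\<close>

text \<open>Wrap the \<open>a p = b q\<close> consecutive integers around a cycle of length \<open>b\<close>, which meets every
  residue \<open>q\<close> times, and let \<open>x\<close> own the \<open>p\<close> integers starting at \<open>p x\<close>. As \<open>p \<le> b\<close>, the integers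
  owned by one \<open>x\<close> have distinct residues.\<close>

lemma biregular_relation:
  fixes a b p q :: nat
  assumes pq: "a * p = b * q" and p: "0 < p" and pb: "p \<le> b"
  obtains R :: "nat \<Rightarrow> nat \<Rightarrow> bool"
  where "\<And>x. x < a \<Longrightarrow> card {y. y < b \<and> R x y} = p"
    and "\<And>y. y < b \<Longrightarrow> card {x. x < a \<and> R x y} = q"
proof -
  define R where "R x y \<longleftrightarrow> (\<exists>t<p. (p * x + t) mod b = y)" for x y :: nat
  have b: "0 < b" using p pb by simp
  show ?thesis
  proof (rule that[of R])
    fix x assume "x < a"
    have "{y. y < b \<and> R x y} = (\<lambda>t. (p * x + t) mod b) ` {..<p}"
      using b by (auto simp: R_def)
    moreover have "inj_on (\<lambda>t. (p * x + t) mod b) {..<p}"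
      using inj_on_subset[OF inj_on_shift[of "p * x" b], of "{..<p}"] pb by (simp add: add.commute)
    ultimately show "card {y. y < b \<and> R x y} = p" by (simp add: card_image)
  next
    fix y assume y: "y < b"
    \<comment> \<open>The integers with residue \<open>y\<close> are the \<open>b s + y\<close> with \<open>s < q\<close>; each is sent to its owner.\<close>
    have "{x. x < a \<and> R x y} = (\<lambda>s. (b * s + y) div p) ` {..<q}"
    proof
      show "{x. x < a \<and> R x y} \<subseteq> (\<lambda>s. (b * s + y) div p) ` {..<q}"
      proof clarsimp
        fix x assume x: "x < a" and "R x y"
        then obtain t where t: "t < p" "(p * x + t) mod b = y" by (auto simp: R_def)
        let ?n = "p * x + t"
        have "?n < p * Suc x" using t by simp
        also have "\<dots> \<le> p * a" using x by (intro mult_le_mono) auto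
        finally have "?n < q * b" using pq by (simp add: mult.commute)
        then have "?n div b < q" using b by (simp add: div_less_iff_less_mult)
        moreover have "b * (?n div b) + y = ?n" using t(2) by (metis mult_div_mod_eq)
        moreover have "?n div p = x" using t p by simp
        ultimately show "x \<in> (\<lambda>s. (b * s + y) div p) ` {..<q}"
          by (intro image_eqI[of _ _ "?n div b"]) auto
      qed
      show "(\<lambda>s. (b * s + y) div p) ` {..<q} \<subseteq> {x. x < a \<and> R x y}"
      proof clarsimp
        fix s assume s: "s < q"
        have "b * s + y < b * Suc s" using y by simp
        also have "\<dots> \<le> b * q" using s by (intro mult_le_mono) auto
        finally have "(b * s + y) div p < a"
          using pq p by (simp add: div_less_iff_less_mult)
        moreover have "R ((b * s + y) div p) y"
          unfolding R_def using p y by (intro exI[of _ "(b * s + y) mod p"]) simp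
        ultimately show "(b * s + y) div p < a \<and> R ((b * s + y) div p) y" by simp
      qed
    qed
    moreover have "inj_on (\<lambda>s. (b * s + y) div p) {..<q}"
    proof (rule strict_mono_on_imp_inj_on, rule strict_mono_onI)
      fix r s :: nat assume "r < s"
      have "(b * r + y) div p < (b * r + y + p) div p" using p by simp
      also have "\<dots> \<le> (b * Suc r + y) div p" using pb by (intro div_le_mono) simp
      also have "\<dots> \<le> (b * s + y) div p" using \<open>r < s\<close>
        by (intro div_le_mono add_le_mono mult_le_mono) auto
      finally show "(b * r + y) div p < (b * s + y) div p" .
    qed
    ultimately show "card {x. x < a \<and> R x y} = q" by (simp add: card_image)
  qed
qed

text \<open>The numbers \<open>p\<close> and \<open>q\<close> are the degrees of orbits of \<open>i\<close>-subsets and \<open>j\<close>-subsets. They count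
  joined orbits of size \<open>v\<close> rather than sets; each such orbit is a 1-design, which explains the
  counts through a point.\<close>

definition balanced :: "nat \<Rightarrow> nat \<Rightarrow> nat \<Rightarrow> nat \<Rightarrow> nat \<Rightarrow> (nat set \<times> nat set) set \<Rightarrow> bool" where
  "balanced v i j p q S \<longleftrightarrow>
     S \<subseteq> ksets v i \<times> ksets v j \<and>
     (\<forall>A\<in>ksets v i. card {B. (A, B) \<in> S} = p * v \<and>
        (\<forall>y<v. card {B. (A, B) \<in> S \<and> y \<in> B} = p * j)) \<and>
     (\<forall>B\<in>ksets v j. card {A. (A, B) \<in> S} = q * v \<and>
        (\<forall>x<v. card {A. (A, B) \<in> S \<and> x \<in> A} = q * i))"

lemma card_union_of_classes:
  assumes "finite K" "finite L"
    and "\<And>l. l \<in> L \<Longrightarrow> card {B \<in> K. c B = l \<and> P B} = n"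
  shows "card {B \<in> K. c B \<in> L \<and> P B} = card L * n"
proof -
  have "{B \<in> K. c B \<in> L \<and> P B} = (\<Union>l\<in>L. {B \<in> K. c B = l \<and> P B})" by auto
  also have "card \<dots> = (\<Sum>l\<in>L. card {B \<in> K. c B = l \<and> P B})"
    using assms(1,2) by (intro card_UN_disjoint) auto
  finally show ?thesis using assms(3) by simp
qed

text \<open>Counting joined orbits from both sides forces the equation between \<open>p\<close> and \<open>q\<close>, here multiplied
  by \<open>v\<close> so that numbers of subsets replace numbers of orbits. Conversely the equation suffices,
  by the biregular relation on the numbers of the orbits.\<close>

lemma balanced_exists:
  assumes v: "0 < v" and copi: "coprime v i" and copj: "coprime v j"
    and pq: "(v choose i) * p = (v choose j) * q"
    and p: "0 < p" and pb: "p * v \<le> v choose j"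
  obtains S where "balanced v i j p q S"
proof -
  obtain c a where a: "a * v = v choose i"
    and c: "\<And>A. A \<in> ksets v i \<Longrightarrow> c A < a"
    and c1: "\<And>l. l < a \<Longrightarrow> card {A \<in> ksets v i. c A = l} = v"
    and c2: "\<And>l y. l < a \<Longrightarrow> y < v \<Longrightarrow> card {A \<in> ksets v i. c A = l \<and> y \<in> A} = i"
    by (rule resolution_into_1_designs[OF v copi]) (rule that)
  obtain d b where b: "b * v = v choose j"
    and d: "\<And>A. A \<in> ksets v j \<Longrightarrow> d A < b"
    and d1: "\<And>l. l < b \<Longrightarrow> card {A \<in> ksets v j. d A = l} = v"
    and d2: "\<And>l y. l < b \<Longrightarrow> y < v \<Longrightarrow> card {A \<in> ksets v j. d A = l \<and> y \<in> A} = j"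
    by (rule resolution_into_1_designs[OF v copj]) (rule that)
  have "v * (a * p) = v * (b * q)" using pq by (simp add: a[symmetric] b[symmetric] ac_simps)
  then have apbq: "a * p = b * q" using v by simp
  have "p * v \<le> b * v" using pb b by simp
  then have "p \<le> b" using v by simp
  from biregular_relation[OF apbq p this] obtain R
    where R1: "\<And>x. x < a \<Longrightarrow> card {y. y < b \<and> R x y} = p"
      and R2: "\<And>y. y < b \<Longrightarrow> card {x. x < a \<and> R x y} = q" by metis
  define S where "S = {(A, B). A \<in> ksets v i \<and> B \<in> ksets v j \<and> R (c A) (d B)}"
  have fwd: "{B. (A, B) \<in> S \<and> P B} = {B \<in> ksets v j. d B \<in> {y. y < b \<and> R (c A) y} \<and> P B}"
    if "A \<in> ksets v i" for A P
    using that d by (auto simp: S_def)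
  have bwd: "{A. (A, B) \<in> S \<and> P A} = {A \<in> ksets v i. c A \<in> {x. x < a \<and> R x (d B)} \<and> P A}"
    if "B \<in> ksets v j" for B P
    using that c by (auto simp: S_def)
  have "balanced v i j p q S"
    unfolding balanced_def
  proof (intro conjI ballI allI impI)
    show "S \<subseteq> ksets v i \<times> ksets v j" by (auto simp: S_def)
  next
    fix A assume A: "A \<in> ksets v i"
    show "card {B. (A, B) \<in> S} = p * v"
      using fwd[OF A, of "\<lambda>_. True"] card_union_of_classes[of "ksets v j" "{y. y < b \<and> R (c A) y}" d "\<lambda>_. True" v]
        d1 R1[OF c[OF A]] by simp
    fix y assume "y < v"
    then show "card {B. (A, B) \<in> S \<and> y \<in> B} = p * j"
      using fwd[OF A, of "\<lambda>B. y \<in> B"] card_union_of_classes[of "ksets v j" "{y. y < b \<and> R (c A) y}" d "\<lambda>B. y \<in> B" j]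
        d2 R1[OF c[OF A]] by simp
  next
    fix B assume B: "B \<in> ksets v j"
    show "card {A. (A, B) \<in> S} = q * v"
      using bwd[OF B, of "\<lambda>_. True"] card_union_of_classes[of "ksets v i" "{x. x < a \<and> R x (d B)}" c "\<lambda>_. True" v]
        c1 R2[OF d[OF B]] by simp
    fix x assume "x < v"
    then show "card {A. (A, B) \<in> S \<and> x \<in> A} = q * i"
      using bwd[OF B, of "\<lambda>A. x \<in> A"] card_union_of_classes[of "ksets v i" "{x. x < a \<and> R x (d B)}" c "\<lambda>A. x \<in> A" i]
        c2 R2[OF d[OF B]] by simp
  qed
  then show ?thesis by (rule that)
qed

section \<open>Coverage of point sets by families of pairs\<close>

definition cover :: "('a set \<times> 'b set) set \<Rightarrow> 'a set \<Rightarrow> 'b set \<Rightarrow> nat" where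
  "cover S T U = card {(A, B) \<in> S. T \<subseteq> A \<and> U \<subseteq> B}"

lemma cover_converse: "cover (S\<inverse>) T U = cover S U T"
proof -
  have "{(A, B) \<in> S\<inverse>. T \<subseteq> A \<and> U \<subseteq> B} = prod.swap ` {(A, B) \<in> S. U \<subseteq> A \<and> T \<subseteq> B}" by force
  then show ?thesis unfolding cover_def by (simp add: card_image)
qed

lemma cover_Un:
  assumes "finite S" "finite S'" "S \<inter> S' = {}"
  shows "cover (S \<union> S') T U = cover S T U + cover S' T U"
proof -
  have "{(A, B) \<in> S \<union> S'. T \<subseteq> A \<and> U \<subseteq> B} =
      {(A, B) \<in> S. T \<subseteq> A \<and> U \<subseteq> B} \<union> {(A, B) \<in> S'. T \<subseteq> A \<and> U \<subseteq> B}" by auto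
  moreover have "finite {(A, B) \<in> S. T \<subseteq> A \<and> U \<subseteq> B}" "finite {(A, B) \<in> S'. T \<subseteq> A \<and> U \<subseteq> B}"
    using assms by (auto intro: finite_subset)
  ultimately show ?thesis
    unfolding cover_def using assms(3) by (simp only:) (intro card_Un_disjoint, auto)
qed

lemma cover_eq_mult:
  assumes S: "S \<subseteq> ksets v i \<times> ksets v j" and T: "T \<subseteq> {..<v}"
    and n: "\<And>A. A \<in> ksets v i \<Longrightarrow> card {B. (A, B) \<in> S \<and> U \<subseteq> B} = n"
  shows "cover S T U = (if card T \<le> i then (v - card T) choose (i - card T) else 0) * n"
proof -
  have fin: "finite {B. (A, B) \<in> S \<and> U \<subseteq> B}" for A
    by (rule finite_subset[of _ "ksets v j"]) (use S in auto)
  have "{(A, B) \<in> S. T \<subseteq> A \<and> U \<subseteq> B} =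
      (SIGMA A:{A \<in> ksets v i. T \<subseteq> A}. {B. (A, B) \<in> S \<and> U \<subseteq> B})" using S by auto
  then have "cover S T U = (\<Sum>A\<in>{A \<in> ksets v i. T \<subseteq> A}. card {B. (A, B) \<in> S \<and> U \<subseteq> B})"
    unfolding cover_def using fin by simp
  also have "\<dots> = card {A \<in> ksets v i. T \<subseteq> A} * n" using n by simp
  finally show ?thesis by (simp add: card_ksets_superset[OF T])
qed

text \<open>If at most one point is prescribed in one of the components, then the number of partners in
  that component is the same for all sets in the other component. What remains is to count the
  sets of the other component that contain the prescribed points.\<close>

lemma cover_balanced:
  assumes S: "balanced v i j p q S" and T: "T \<subseteq> {..<v}"
  shows "cover S T {} = (if card T \<le> i then (v - card T) choose (i - card T) else 0) * (p * v)"
    and "y < v \<Longrightarrow> cover S T {y} = (if card T \<le> i then (v - card T) choose (i - card T) else 0) * (p * j)"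
    and "U \<subseteq> {..<v} \<Longrightarrow> cover S {} U = (if card U \<le> j then (v - card U) choose (j - card U) else 0) * (q * v)"
    and "U \<subseteq> {..<v} \<Longrightarrow> x < v \<Longrightarrow>
           cover S {x} U = (if card U \<le> j then (v - card U) choose (j - card U) else 0) * (q * i)"
proof -
  have S': "S \<subseteq> ksets v i \<times> ksets v j" "S\<inverse> \<subseteq> ksets v j \<times> ksets v i" using S by (auto simp: balanced_def)
  show "cover S T {} = (if card T \<le> i then (v - card T) choose (i - card T) else 0) * (p * v)"
    using S by (intro cover_eq_mult[OF S'(1) T]) (simp add: balanced_def)
  show "cover S T {y} = (if card T \<le> i then (v - card T) choose (i - card T) else 0) * (p * j)" if "y < v"
    using S that by (intro cover_eq_mult[OF S'(1) T]) (simp add: balanced_def)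
  show "cover S {} U = (if card U \<le> j then (v - card U) choose (j - card U) else 0) * (q * v)"
    if "U \<subseteq> {..<v}"
    using S that by (subst cover_converse[symmetric], intro cover_eq_mult[OF S'(2)]) (auto simp: balanced_def)
  show "cover S {x} U = (if card U \<le> j then (v - card U) choose (j - card U) else 0) * (q * i)"
    if "U \<subseteq> {..<v}" "x < v"
    using S that by (subst cover_converse[symmetric], intro cover_eq_mult[OF S'(2)]) (auto simp: balanced_def)
qed

section \<open>Doubling the point set\<close>

text \<open>The disjoint union of \<open>A\<close> and \<open>B\<close>, the second copy of the points being \<open>v, \<dots>, 2 v - 1\<close>.\<close>

definition join :: "nat \<Rightarrow> nat set \<Rightarrow> nat set \<Rightarrow> nat set" where
  "join v A B = A \<union> (+) v ` B"

lemma join_subset_iff: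
  assumes "A \<subseteq> {..<v}" "T \<subseteq> {..<v}"
  shows "join v T U \<subseteq> join v A B \<longleftrightarrow> T \<subseteq> A \<and> U \<subseteq> B"
  using assms unfolding join_def by fastforce

lemma card_join:
  assumes "A \<subseteq> {..<v}" "finite B"
  shows "card (join v A B) = card A + card B"
proof -
  have "finite A" using assms finite_subset by blast
  moreover have "A \<inter> (+) v ` B = {}" using assms by force
  ultimately show ?thesis using assms by (simp add: join_def card_Un_disjoint card_image)
qed

lemma join_cases:
  assumes "T \<subseteq> {..<2 * v}"
  obtains T1 T2 where "T1 \<subseteq> {..<v}" "T2 \<subseteq> {..<v}" "T = join v T1 T2"
proof (rule that[of "T \<inter> {..<v}" "{x. v + x \<in> T}"])
  have "x \<in> (+) v ` {x. v + x \<in> T}" if "x \<in> T" "\<not> x < v" for x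
    using that by (intro image_eqI[of _ _ "x - v"]) auto
  then show "T = join v (T \<inter> {..<v}) {x. v + x \<in> T}"
    by (auto simp: join_def)
qed (use assms in auto)

lemma simple_design_from_pairs:
  assumes S: "S \<subseteq> {(A, B). A \<subseteq> {..<v} \<and> B \<subseteq> {..<v} \<and> card A + card B = k}"
    and cov: "\<And>T U. T \<subseteq> {..<v} \<Longrightarrow> U \<subseteq> {..<v} \<Longrightarrow> card T + card U = t \<Longrightarrow> cover S T U = l"
  shows "simple_design_exists t (2 * v) k (real l)"
proof -
  let ?f = "\<lambda>(A, B). join v A B"
  define D where "D = ?f ` S"
  have finS: "finite S"
    by (rule finite_subset[of _ "Pow {..<v} \<times> Pow {..<v}"]) (use S in auto)
  have inj: "inj_on ?f S"
  proof (rule inj_onI, clarify)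
    fix A B A' B' assume "(A, B) \<in> S" "(A', B') \<in> S" and eq: "join v A B = join v A' B'"
    then have *: "A \<subseteq> {..<v}" "A' \<subseteq> {..<v}" using S by auto
    have "join v A B \<subseteq> join v A' B'" "join v A' B' \<subseteq> join v A B" using eq by auto
    then show "A = A' \<and> B = B'" using * by (auto simp: join_subset_iff)
  qed
  have design: "is_design t (2 * v) k l {..<2 * v} (mset_set D)"
    unfolding is_design_def
  proof (intro conjI ballI allI impI)
    fix b assume "b \<in># mset_set D"
    then obtain A B where AB: "(A, B) \<in> S" "b = join v A B"
      using finS by (auto simp: D_def)
    then have *: "A \<subseteq> {..<v}" "B \<subseteq> {..<v}" "card A + card B = k" using S by auto
    show "b \<subseteq> {..<2 * v}" using * AB by (fastforce simp: join_def)
    show "card b = k" using * AB by (simp add: card_join finite_subset)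
  next
    fix T assume T: "T \<subseteq> {..<2 * v} \<and> card T = t"
    then obtain T1 T2 where T12: "T1 \<subseteq> {..<v}" "T2 \<subseteq> {..<v}" "T = join v T1 T2"
      using join_cases by metis
    then have c: "card T1 + card T2 = t" using T by (simp add: card_join finite_subset)
    have "T \<subseteq> join v A B \<longleftrightarrow> T1 \<subseteq> A \<and> T2 \<subseteq> B" if "(A, B) \<in> S" for A B
    proof -
      have "A \<subseteq> {..<v}" using S that by auto
      then show ?thesis using join_subset_iff T12 by simp
    qed
    then have "{b \<in> D. T \<subseteq> b} = ?f ` {(A, B) \<in> S. T1 \<subseteq> A \<and> T2 \<subseteq> B}"
      unfolding D_def by (auto simp del: insert_subset) blast
    moreover have "inj_on ?f {(A, B) \<in> S. T1 \<subseteq> A \<and> T2 \<subseteq> B}"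
      by (rule inj_on_subset[OF inj]) auto
    ultimately have "card {b \<in> D. T \<subseteq> b} = cover S T1 T2"
      by (simp add: cover_def card_image)
    also have "\<dots> = l" using cov T12 c by simp
    finally show "size {#b \<in># mset_set D. T \<subseteq> b#} = l"
      using finS by (simp add: D_def filter_mset_mset_set)
  qed auto
  have "simple_blocks (mset_set D)"
    by (simp add: simple_blocks_def count_mset_set')
  with design show ?thesis unfolding simple_design_exists_def by blast
qed

text \<open>
  The parameter \<open>n\<close> is the degree among orbits of \<open>h\<close>-subsets. The hypothesis on \<open>c\<close> says that there
  are exactly \<open>c\<close> times as many \<open>(2h - 2)\<close>-subsets as pairs, because
  \<open>(v choose (2h - 2)) ((2h - 2) choose 2) = (v choose 2) ((v - 2) choose (2h - 4))\<close>; so joining every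
  orbit of \<open>(2h - 2)\<close>-subsets to \<open>m\<close> orbits of pairs can be arranged to give each orbit of pairs the
  degree \<open>c m\<close>. The last two hypotheses are the coverage counts of the triples inside one copy of
  the points and of the other triples. A triple inside one copy is never inside the
  two-element part of a block, so only two of the three types contribute to the first count.
\<close>

lemma simple_3_design_of_double:
  fixes v h m n c :: nat and r :: real
  assumes h: "3 \<le> h" "2 * h \<le> v"
    and cop: "coprime v 2" "coprime v h" "coprime v (2 * h - 2)"
    and m: "0 < m" "2 * m < v"
    and n: "0 < n" "n * v \<le> v choose h"
    and c: "(v - 2) choose (2 * h - 4) = ((2 * h - 2) choose 2) * c"
    and r1: "r = real ((v - 3) choose (2 * h - 5)) * real (m * v) + real ((v - 3) choose (h - 3)) * real (n * v)"
    and r2: "r = real ((v - 2) choose (2 * h - 4)) * real (2 * m) + real (c * m * (2 * h - 2))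
                 + real ((v - 2) choose (h - 2)) * real (n * h)"
  shows "simple_design_exists 3 (2 * v) (2 * h) r"
proof -
  have v: "0 < v" using h by linarith
  define l where "l = ((v - 3) choose (2 * h - 5)) * (m * v) + ((v - 3) choose (h - 3)) * (n * v)"
  have rl: "r = real l" by (simp add: r1 l_def)
  have "real l = real (((v - 2) choose (2 * h - 4)) * (2 * m) + c * m * (2 * h - 2) + ((v - 2) choose (h - 2)) * (n * h))"
    unfolding rl[symmetric] by (simp only: r2 of_nat_add of_nat_mult)
  then have l2: "l = ((v - 2) choose (2 * h - 4)) * (2 * m) + c * m * (2 * h - 2) + ((v - 2) choose (h - 2)) * (n * h)"
    by (simp only: of_nat_eq_iff)
  have mv: "m * v \<le> v choose 2"
  proof -
    have "2 * m * v \<le> (v - 1) * v" using m by (intro mult_le_mono) auto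
    then have "m * v \<le> (v - 1) * v div 2" by linarith
    then show ?thesis by (simp add: choose_two mult.commute)
  qed
  have q: "(v choose (2 * h - 2)) * m = (v choose 2) * (c * m)"
  proof -
    have "(v choose (2 * h - 2)) * ((2 * h - 2) choose 2) = (v choose 2) * ((v - 2) choose (2 * h - 2 - 2))"
      using h by (intro choose_mult) auto
    also have "2 * h - 2 - 2 = 2 * h - 4" by simp
    finally have "(v choose (2 * h - 2)) * ((2 * h - 2) choose 2) = (v choose 2) * c * ((2 * h - 2) choose 2)"
      unfolding c by (simp only: ac_simps)
    moreover have "0 < (2 * h - 2) choose 2" using h by simp
    ultimately have "v choose (2 * h - 2) = (v choose 2) * c" by (metis mult_right_cancel less_not_refl)
    then show ?thesis by simp
  qed
  obtain S where S: "balanced v (2 * h - 2) 2 m (c * m) S"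
    using balanced_exists[OF v cop(3,1) q m(1) mv] by metis
  obtain H where H: "balanced v h h n n H"
    using balanced_exists[OF v cop(2,2) refl n] by metis
  have sub: "S \<subseteq> ksets v (2 * h - 2) \<times> ksets v 2" "S\<inverse> \<subseteq> ksets v 2 \<times> ksets v (2 * h - 2)"
      "H \<subseteq> ksets v h \<times> ksets v h"
    using S H by (auto simp: balanced_def)
  have fin: "finite S" "finite H"
    using sub by (auto intro: finite_subset)
  have disj: "ksets v x \<inter> ksets v y = {}" if "x \<noteq> y" for x y using that by (auto simp: ksets_def)
  have disj1: "S \<inter> S\<inverse> = {}"
    using sub disj[of "2 * h - 2" 2] h by fastforce
  have disj2: "(S \<union> S\<inverse>) \<inter> H = {}"
    using sub disj[of h "2 * h - 2"] disj[of h 2] h by fastforce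
  have total: "cover (S \<union> S\<inverse> \<union> H) T U = cover S T U + cover S U T + cover H T U" for T U
    using fin disj1 disj2 by (simp add: cover_Un cover_converse)
  show ?thesis
    unfolding rl
  proof (rule simple_design_from_pairs[of "S \<union> S\<inverse> \<union> H"])
    show "S \<union> S\<inverse> \<union> H \<subseteq> {(A, B). A \<subseteq> {..<v} \<and> B \<subseteq> {..<v} \<and> card A + card B = 2 * h}"
      using sub h by (fastforce simp: ksets_def)
  next
    fix T U assume T: "T \<subseteq> {..<v}" and U: "U \<subseteq> {..<v}" and c: "card T + card U = 3"
    note covS = cover_balanced[OF S] and covH = cover_balanced[OF H]
    have fTU: "finite T" "finite U" using T U finite_subset by blast+
    consider "card T = 3" "U = {}" | x where "card T = 2" "U = {x}"
      | x where "T = {x}" "card U = 2" | "T = {}" "card U = 3"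
    proof -
      have "card U = 0 \<or> card U = 1 \<or> card U = 2 \<or> card U = 3" using c by linarith
      then show ?thesis using c that fTU by (auto simp: card_1_singleton_iff)
    qed
    then show "cover (S \<union> S\<inverse> \<union> H) T U = l"
    proof cases
      case 1
      then show ?thesis using h T by (simp add: total covS covH l_def)
    next
      case 2
      then show ?thesis using h T U by (simp add: total covS covH l2)
    next
      case 3
      then show ?thesis using h T U by (simp add: total covS covH l2)
    next
      case 4
      then show ?thesis using h U by (simp add: total covS covH l_def)
    qed
  qed
qed

section \<open>Block sizes 8 and 10\<close>

lemma real_binomial_eq_prod:
  "real (n choose k) = (\<Prod>i<k. real n - real i) / fact k"
  by (simp add: binomial_gbinomial gbinomial_prod_rev atLeast0LessThan)

text \<open>
  Here \<open>h = 4\<close> and \<open>c = ((v - 2) choose 4) / 15\<close>. Equating the two coverage counts and solving for the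
  degree among orbits of 4-subsets gives \<open>(v + 3)(v - 5) m / 15\<close>. Both quotients are integers: the
  residue of \<open>v\<close> modulo 6 accounts for the factor 3 and its residue modulo 5 for the factor 5.
\<close>

lemma simple_3_designs_block_size_8:
  fixes v m :: nat
  assumes v: "6 < v" and m: "0 < m" "2 * m < v"
    and v6: "v mod 6 = 5" and v5: "v mod 5 = 0 \<or> v mod 5 = 2"
  shows "simple_design_exists 3 (2 * v) 8
           (7 / 30 * real v * (real v - 2) * (real v - 3) * (real v - 5) * real m)"
proof -
  \<comment> \<open>All factors \<open>v - 2, \<dots>, v - 5\<close> become sums in terms of \<open>y\<close>, which avoids truncated subtraction.\<close>
  define y where "y = v - 5"
  have vy: "v = y + 5" using v by (simp add: y_def)
  have y3: "3 dvd y" using v6 vy by presburger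
  with v vy have y: "3 \<le> y" by presburger
  have y5: "y mod 5 = 0 \<or> y mod 5 = 2" using v5 vy by presburger
  have "odd v" "\<not> 3 dvd v" using v6 by presburger+
  then have cop: "coprime v 2" "coprime v 3"
    by (auto simp: coprime_commute[of v] intro: prime_imp_coprime_nat)
  have cop46: "coprime v 4" "coprime v 6"
    using cop coprime_mult_right_iff[of v 2 2] coprime_mult_right_iff[of v 2 3] by auto
  have prod: "((v - 2) choose 4) * 24 = (y + 3) * (y + 2) * (y + 1) * y"
  proof -
    have "real (((v - 2) choose 4) * 24) = real ((y + 3) * (y + 2) * (y + 1) * y)"
      by (simp add: vy real_binomial_eq_prod lessThan_nat_numeral lessThan_Suc fact_numeral algebra_simps)
    then show ?thesis by (simp only: of_nat_eq_iff)
  qed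
  have "5 dvd ((v - 2) choose 4)"
  proof -
    have "5 dvd y \<or> 5 dvd y + 3" using y5 by presburger
    then have "5 dvd ((v - 2) choose 4) * 24" unfolding prod by (blast intro: dvd_mult dvd_mult2)
    then show ?thesis by (simp add: coprime_dvd_mult_left_iff coprime_iff_gcd_eq_1 gcd_non_0_nat)
  qed
  moreover have "3 dvd ((v - 2) choose 4)"
  proof -
    \<comment> \<open>Both \<open>y = v - 5\<close> and \<open>y + 3 = v - 2\<close> are divisible by 3; one of the two factors cancels against 24.\<close>
    obtain z where z: "y = 3 * z" using y3 by blast
    have "((v - 2) choose 4) * 8 = 3 * ((z + 1) * (y + 2) * (y + 1) * z)"
      using prod by (simp add: z algebra_simps)
    then have "3 dvd ((v - 2) choose 4) * 8" by simp
    then show ?thesis by (simp add: coprime_dvd_mult_left_iff coprime_iff_gcd_eq_1 gcd_non_0_nat)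
  qed
  ultimately have "5 * 3 dvd ((v - 2) choose 4)" by (intro divides_mult) (auto simp: coprime_iff_gcd_eq_1 gcd_non_0_nat)
  then obtain c where c: "((v - 2) choose 4) = 15 * c" by auto
  have "5 dvd (y + 8) * y"
  proof -
    have "5 dvd y \<or> 5 dvd y + 8" using y5 by presburger
    then show ?thesis by (blast intro: dvd_mult dvd_mult2)
  qed
  moreover have "3 dvd (y + 8) * y" using y3 by simp
  ultimately have "5 * 3 dvd (y + 8) * y" by (intro divides_mult) (auto simp: coprime_iff_gcd_eq_1 gcd_non_0_nat)
  then obtain w where w: "(y + 8) * y = 15 * w" by auto
  have "0 < w"
  proof (rule ccontr)
    assume "\<not> 0 < w"
    with w y show False by simp
  qed
  have rw: "real w = (real y + 8) * real y / 15"
    using arg_cong[OF w, of real] by (simp add: algebra_simps)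
  have rc: "real c = (real y + 3) * (real y + 2) * (real y + 1) * real y / 360"
    using arg_cong[OF prod, of real] by (simp add: c algebra_simps)
  have "simple_design_exists 3 (2 * v) (2 * 4)
           (7 / 30 * real v * (real v - 2) * (real v - 3) * (real v - 5) * real m)"
  proof (rule simple_3_design_of_double[where n = "w * m" and c = c and m = m])
    \<comment> \<open>There are enough orbits of 4-subsets: replace \<open>2 m\<close> by its upper bound \<open>v - 1 = y + 4\<close>.\<close>
    show "w * m * v \<le> v choose 4"
    proof -
      have "real (w * m * v) = (real y + 8) * real y / 30 * (2 * real m) * (real y + 5)"
        by (simp add: rw vy)
      also have "\<dots> \<le> (real y + 8) * real y / 30 * (real y + 4) * (real y + 5)"
        using m vy by (intro mult_right_mono mult_left_mono) auto
      also have "\<dots> \<le> (real y + 3) * (real y + 2) / 24 * (real y + 4) * (real y + 5)"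
      proof (intro mult_right_mono)
        have "0 \<le> (2 * real y - 7) ^ 2" by simp
        then show "(real y + 8) * real y / 30 \<le> (real y + 3) * (real y + 2) / 24"
          by (simp add: power2_eq_square field_simps)
      qed auto
      also have "\<dots> = real (v choose 4)"
        by (simp add: vy real_binomial_eq_prod lessThan_nat_numeral lessThan_Suc fact_numeral algebra_simps)
      finally show ?thesis by (simp only: of_nat_le_iff)
    qed
  next
    show "7 / 30 * real v * (real v - 2) * (real v - 3) * (real v - 5) * real m =
        real ((v - 3) choose (2 * 4 - 5)) * real (m * v) + real ((v - 3) choose (4 - 3)) * real (w * m * v)"
      by (simp add: vy rw real_binomial_eq_prod lessThan_nat_numeral lessThan_Suc fact_numeral field_simps)
    show "7 / 30 * real v * (real v - 2) * (real v - 3) * (real v - 5) * real m =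
        real ((v - 2) choose (2 * 4 - 4)) * real (2 * m) + real (c * m * (2 * 4 - 2))
          + real ((v - 2) choose (4 - 2)) * real (w * m * 4)"
      by (simp add: vy rw rc real_binomial_eq_prod lessThan_nat_numeral lessThan_Suc fact_numeral field_simps)
  qed (use y vy m cop cop46 c \<open>0 < w\<close> in \<open>auto simp: choose_two\<close>)
  then show ?thesis by simp
qed

text \<open>
  Here \<open>h = 5\<close> and \<open>c = ((v - 2) choose 6) / 28\<close>. Equating the two coverage counts and solving for the
  degree among orbits of 5-subsets gives \<open>(13 v + 16)(v - 6)(v - 7) m / 840\<close>, where
  \<open>840 = 8 \<cdot> 3 \<cdot> 5 \<cdot> 7\<close>. The hypotheses provide the factors 8, 5 and 7; the factor 3 is always present,
  since \<open>13 v + 16 \<equiv> v + 1\<close>, \<open>v - 6 \<equiv> v\<close> and \<open>v - 7 \<equiv> v - 1\<close> modulo 3.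
\<close>

lemma simple_3_designs_block_size_10:
  fixes v m :: nat
  assumes v: "8 < v" and m: "0 < m" "2 * m < v"
    and v8: "v mod 8 = 7" and v5: "v mod 5 \<in> {1, 2, 3}" and v7: "v mod 7 \<in> {0, 2, 6}"
  shows "simple_design_exists 3 (2 * v) 10
           (81 * real v * real m / (7 * (real v - 5)) * real ((v - 2) choose 6))"
proof -
  define y where "y = v - 7"
  have vy: "v = y + 7" using v by (simp add: y_def)
  have y8: "8 dvd y" using v8 vy by presburger
  with v vy have y: "3 \<le> y" by presburger
  have y5: "y mod 5 \<in> {1, 0, 4}" using v5 unfolding vy insert_iff empty_iff by presburger
  have y7: "y mod 7 \<in> {0, 2, 6}" using v7 vy by simp
  have "odd v" using v8 by presburger
  moreover have "\<not> 5 dvd v" using v5 by auto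
  ultimately have cop: "coprime v 2" "coprime v 5"
    by (auto simp: coprime_commute[of v] intro: prime_imp_coprime_nat)
  have cop8: "coprime v 8"
    using cop(1) coprime_power_right_iff[of v 2 3] by simp
  have prod: "((v - 2) choose 6) * 720 = (y + 5) * (y + 4) * (y + 3) * (y + 2) * (y + 1) * y"
  proof -
    have "real (((v - 2) choose 6) * 720) = real ((y + 5) * (y + 4) * (y + 3) * (y + 2) * (y + 1) * y)"
      by (simp add: vy real_binomial_eq_prod lessThan_nat_numeral lessThan_Suc fact_numeral algebra_simps)
    then show ?thesis by (simp only: of_nat_eq_iff)
  qed
  have "7 dvd ((v - 2) choose 6)"
  proof -
    have "7 dvd y \<or> 7 dvd y + 5 \<or> 7 dvd y + 1" using y7 unfolding insert_iff empty_iff by presburger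
    then have "7 dvd ((v - 2) choose 6) * 720" unfolding prod by (blast intro: dvd_mult dvd_mult2)
    then show ?thesis by (simp add: coprime_dvd_mult_left_iff coprime_iff_gcd_eq_1 gcd_non_0_nat)
  qed
  moreover have "4 dvd ((v - 2) choose 6)"
  proof -
    \<comment> \<open>Since \<open>y = v - 7\<close> is divisible by 8, the product is divisible by \<open>2 \<cdot> 4 \<cdot> 8 = 64\<close>, and \<open>720 = 16 \<cdot> 45\<close>.\<close>
    obtain z where z: "y = 8 * z" using y8 by blast
    have "((v - 2) choose 6) * 45 = 4 * ((y + 5) * (2 * z + 1) * (y + 3) * (4 * z + 1) * (y + 1) * z)"
      using prod by (simp add: z algebra_simps)
    then have "4 dvd ((v - 2) choose 6) * 45" by simp
    then show ?thesis by (simp add: coprime_dvd_mult_left_iff coprime_iff_gcd_eq_1 gcd_non_0_nat)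
  qed
  ultimately have "7 * 4 dvd ((v - 2) choose 6)" by (intro divides_mult) (auto simp: coprime_iff_gcd_eq_1 gcd_non_0_nat)
  then obtain c where c: "((v - 2) choose 6) = 28 * c" by auto
  let ?p = "(13 * y + 107) * (y + 1) * y"
  have "8 dvd ?p" using y8 by simp
  moreover have "3 dvd ?p"
  proof -
    have "3 dvd 13 * y + 107 \<or> 3 dvd y + 1 \<or> 3 dvd y" by presburger
    then show ?thesis by (blast intro: dvd_mult dvd_mult2)
  qed
  moreover have "5 dvd ?p"
  proof -
    have "5 dvd 13 * y + 107 \<or> 5 dvd y + 1 \<or> 5 dvd y" using y5 unfolding insert_iff empty_iff by presburger
    then show ?thesis by (blast intro: dvd_mult dvd_mult2)
  qed
  moreover have "7 dvd ?p"
  proof -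
    have "7 dvd 13 * y + 107 \<or> 7 dvd y + 1 \<or> 7 dvd y" using y7 unfolding insert_iff empty_iff by presburger
    then show ?thesis by (blast intro: dvd_mult dvd_mult2)
  qed
  ultimately have "8 * 3 * 5 * 7 dvd ?p" by (intro divides_mult) (auto simp: coprime_iff_gcd_eq_1 gcd_non_0_nat)
  then obtain w where w: "?p = 840 * w" by auto
  have "0 < w"
  proof (rule ccontr)
    assume "\<not> 0 < w"
    with w y show False by simp
  qed
  have rw: "real w = (13 * real y + 107) * (real y + 1) * real y / 840"
    using arg_cong[OF w, of real] by (simp add: algebra_simps)
  have rc: "real c = (real y + 5) * (real y + 4) * (real y + 3) * (real y + 2) * (real y + 1) * real y / 20160"
    using arg_cong[OF prod, of real] by (simp add: c algebra_simps)
  have "simple_design_exists 3 (2 * v) (2 * 5)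
           (81 * real v * real m / (7 * (real v - 5)) * real ((v - 2) choose 6))"
  proof (rule simple_3_design_of_double[where n = "w * m" and c = c and m = m])
    \<comment> \<open>There are enough orbits of 5-subsets: replace \<open>2 m\<close> by its upper bound \<open>v - 1 = y + 6\<close>.\<close>
    show "w * m * v \<le> v choose 5"
    proof -
      have "real (w * m * v) = (13 * real y + 107) * (real y + 1) * real y / 1680 * (2 * real m) * (real y + 7)"
        by (simp add: rw vy)
      also have "\<dots> \<le> (13 * real y + 107) * (real y + 1) * real y / 1680 * (real y + 6) * (real y + 7)"
        using m vy by (intro mult_right_mono mult_left_mono) auto
      also have "\<dots> \<le> (real y + 5) * (real y + 4) * (real y + 3) / 120 * (real y + 6) * (real y + 7)"
      proof (intro mult_right_mono)
        show "(13 * real y + 107) * (real y + 1) * real y / 1680 \<le> (real y + 5) * (real y + 4) * (real y + 3) / 120"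
          by (simp add: field_simps)
      qed auto
      also have "\<dots> = real (v choose 5)"
        by (simp add: vy real_binomial_eq_prod lessThan_nat_numeral lessThan_Suc fact_numeral algebra_simps)
      finally show ?thesis by (simp only: of_nat_le_iff)
    qed
  next
    show "81 * real v * real m / (7 * (real v - 5)) * real ((v - 2) choose 6) =
        real ((v - 3) choose (2 * 5 - 5)) * real (m * v) + real ((v - 3) choose (5 - 3)) * real (w * m * v)"
      by (simp add: vy rw real_binomial_eq_prod lessThan_nat_numeral lessThan_Suc fact_numeral field_simps)
    show "81 * real v * real m / (7 * (real v - 5)) * real ((v - 2) choose 6) =
        real ((v - 2) choose (2 * 5 - 4)) * real (2 * m) + real (c * m * (2 * 5 - 2))
          + real ((v - 2) choose (5 - 2)) * real (w * m * 5)"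
      by (simp add: vy rw rc real_binomial_eq_prod lessThan_nat_numeral lessThan_Suc fact_numeral field_simps)
  qed (use y vy m cop cop8 c \<open>0 < w\<close> in \<open>auto simp: choose_two\<close>)
  then show ?thesis by simp
qed

theorem corollary3p8:
  shows "(\<forall>v m :: nat. v > 6 \<and> m > 0 \<and>
            (\<exists>a\<in>{5, 17, 35, 47}. [v = a] (mod 60)) \<and>
            real m \<le> (real v - 1) / 2 \<longrightarrow>
            simple_design_exists 3 (2 * v) 8
              (7 / 30 * real v * (real v - 2) * (real v - 3) * (real v - 5) * real m)) \<and>
         (\<forall>v m :: nat. v > 8 \<and> m > 0 \<and>
            (\<exists>a\<in>{7, 23, 63, 111, 167, 191, 223, 231, 247}. [v = a] (mod 280)) \<and>
            real m \<le> (real v - 1) / 2 \<longrightarrow>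
            simple_design_exists 3 (2 * v) 10
              (81 * real v * real m / (7 * (real v - 5)) * real ((v - 2) choose 6)))"
proof (intro conjI allI impI; elim conjE)
  fix v m :: nat
  assume v: "6 < v" "0 < m" and cong: "\<exists>a\<in>{5, 17, 35, 47}. [v = a] (mod 60)"
    and m: "real m \<le> (real v - 1) / 2"
  from cong obtain a where a: "a \<in> {5, 17, 35, 47}" and "[v = a] (mod 60)" by blast
  then have "[v = a] (mod 6)" "[v = a] (mod 5)"
    by (auto elim: cong_dvd_modulus_nat)
  then have resid: "v mod 6 = 5" "v mod 5 = 0 \<or> v mod 5 = 2"
    using a by (auto simp: cong_def)
  have "real (2 * m) < real v" using m by simp
  then have "2 * m < v" by (simp only: of_nat_less_iff)
  with resid show "simple_design_exists 3 (2 * v) 8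
      (7 / 30 * real v * (real v - 2) * (real v - 3) * (real v - 5) * real m)"
    using v by (intro simple_3_designs_block_size_8) auto
next
  fix v m :: nat
  assume v: "8 < v" "0 < m"
    and cong: "\<exists>a\<in>{7, 23, 63, 111, 167, 191, 223, 231, 247}. [v = a] (mod 280)"
    and m: "real m \<le> (real v - 1) / 2"
  from cong obtain a where a: "a \<in> {7, 23, 63, 111, 167, 191, 223, 231, 247}" and "[v = a] (mod 280)" by blast
  then have "[v = a] (mod 8)" "[v = a] (mod 5)" "[v = a] (mod 7)"
    by (auto elim: cong_dvd_modulus_nat)
  then have resid: "v mod 8 = 7" "v mod 5 \<in> {1, 2, 3}" "v mod 7 \<in> {0, 2, 6}"
    using a by (auto simp: cong_def)
  have "real (2 * m) < real v" using m by simp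
  then have "2 * m < v" by (simp only: of_nat_less_iff)
  with resid show "simple_design_exists 3 (2 * v) 10
      (81 * real v * real m / (7 * (real v - 5)) * real ((v - 2) choose 6))"
    using v by (intro simple_3_designs_block_size_10) auto
qed

end
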